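(* Let $R$ be a nonzero unital ring. With the notation of the context: 1. The sets ${}'\mathcal{C}_R^{le}$, ${\mathcal{C}'_R}^{re}$ and $\mathcal{C}_R^e$ are multiplicative sets of $R$. 2. Suppose that ${}'\mathcal{C}_R^{le}$ meets all the essential left ideals of $R$. Then ${}'\mathcal{C}_R^{le}$ is a left denominator set of $R$. 3. Suppose that ${\mathcal{C}'_R}^{re}$ meets all the essential right ideals of $R$. Then ${\mathcal{C}'_R}^{re}$ is a right denominator set of $R$. 4. Suppose that $\mathcal{C}_R^e$ meets all the essential left ideals and all the essential right ideals of $R$. Then $\mathcal{C}_R^e\in\mathrm{Den}(R,0)$.
   Context: A subset $S$ of $R$ is multiplicative if $1\in S$, $SS\subseteq S$, $0\notin S$. A multiplicative set $S$ is a left Ore set if $Sr\cap Rs\neq\emptyset$ for all $r\in R$, $s\in S$, and a left denominator set if moreover $rs=0$ ($r\in R$, $s\in S$) implies $tr=0$ for some $t\in S$. Right Ore and right denominator sets are defined symmetrically. $\mathrm{Den}(R,0)$ is the set of left and right denominator sets $S$ of $R$ with $\{r\in R\mid sr=0\text{ for some }s\in S\}=0$ (equivalently $\{r\in R\mid rs=0\text{ for some }s\in S\}=0$). A left (right) ideal is essential if it meets every nonzero left (right) ideal nontrivially. $R^{le}$ is the set of $r\in R$ such that the left ideal $Rr$ is essential; $R^{re}$ is the set of $r\in R$ such that the right ideal $rR$ is essential; $R^e=R^{le}\cap R^{re}$. ${}'\mathcal{C}_R=\{c\in R\mid rc=0\Rightarrow r=0\}$, $\mathcal{C}'_R=\{c\in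 R\mid cr=0\Rightarrow r=0\}$, $\mathcal{C}_R={}'\mathcal{C}_R\cap\mathcal{C}'_R$. ${}'\mathcal{C}_R^{le}:={}'\mathcal{C}_R\cap R^{le}$, ${\mathcal{C}'_R}^{re}:=\mathcal{C}'_R\cap R^{re}$, $\mathcal{C}_R^e:={}'\mathcal{C}_R^{le}\cap{\mathcal{C}'_R}^{re}=\mathcal{C}_R\cap R^e$. *)

theory Defs
  imports Main
begin

text \<open>
  The ring is the type \<open>'a :: ring_1\<close>: unital, not necessarily commutative, and nonzero
  (\<open>ring_1\<close> includes \<open>0 \<noteq> 1\<close>).
\<close>

text \<open>Closure under negation follows from closure under multiplication by \<open>-1\<close>.\<close>

definition left_ideal :: "'a::ring_1 set \<Rightarrow> bool" where
  "left_ideal I \<longleftrightarrow> 0 \<in> I \<and> (\<forall>x\<in>I. \<forall>y\<in>I. x + y \<in> I) \<and> (\<forall>r. \<forall>x\<in>I. r * x \<in> I)"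

definition right_ideal :: "'a::ring_1 set \<Rightarrow> bool" where
  "right_ideal I \<longleftrightarrow> 0 \<in> I \<and> (\<forall>x\<in>I. \<forall>y\<in>I. x + y \<in> I) \<and> (\<forall>r. \<forall>x\<in>I. x * r \<in> I)"

definition essential_left_ideal :: "'a::ring_1 set \<Rightarrow> bool" where
  "essential_left_ideal I \<longleftrightarrow>
     left_ideal I \<and> (\<forall>J. left_ideal J \<and> J \<noteq> {0} \<longrightarrow> I \<inter> J \<noteq> {0})"

definition essential_right_ideal :: "'a::ring_1 set \<Rightarrow> bool" where
  "essential_right_ideal I \<longleftrightarrow>
     right_ideal I \<and> (\<forall>J. right_ideal J \<and> J \<noteq> {0} \<longrightarrow> I \<inter> J \<noteq> {0})"

definition multiplicative_set :: "'a::ring_1 set \<Rightarrow> bool" where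
  "multiplicative_set S \<longleftrightarrow> 1 \<in> S \<and> (\<forall>s\<in>S. \<forall>t\<in>S. s * t \<in> S) \<and> 0 \<notin> S"

definition left_Ore_set :: "'a::ring_1 set \<Rightarrow> bool" where
  "left_Ore_set S \<longleftrightarrow> multiplicative_set S \<and>
     (\<forall>r. \<forall>s\<in>S. (\<lambda>t. t * r) ` S \<inter> range (\<lambda>u. u * s) \<noteq> {})"

definition right_Ore_set :: "'a::ring_1 set \<Rightarrow> bool" where
  "right_Ore_set S \<longleftrightarrow> multiplicative_set S \<and>
     (\<forall>r. \<forall>s\<in>S. (\<lambda>t. r * t) ` S \<inter> range (\<lambda>u. s * u) \<noteq> {})"

definition left_denominator_set :: "'a::ring_1 set \<Rightarrow> bool" where
  "left_denominator_set S \<longleftrightarrow> left_Ore_set S \<and>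
     (\<forall>r. \<forall>s\<in>S. r * s = 0 \<longrightarrow> (\<exists>t\<in>S. t * r = 0))"

definition right_denominator_set :: "'a::ring_1 set \<Rightarrow> bool" where
  "right_denominator_set S \<longleftrightarrow> right_Ore_set S \<and>
     (\<forall>r. \<forall>s\<in>S. s * r = 0 \<longrightarrow> (\<exists>t\<in>S. r * t = 0))"

text \<open>\<open>Den(R,0)\<close>\<close>

definition Den0 :: "'a::ring_1 set set" where
  "Den0 = {S. left_denominator_set S \<and> right_denominator_set S \<and>
              {r. \<exists>s\<in>S. s * r = 0} = {0}}"

text \<open>For a left and right denominator set, the annihilator condition may equivalently be
  imposed on the other side.\<close>

lemma Den0_right:
  "(Den0 :: 'a::ring_1 set set) =
     {S. left_denominator_set S \<and> right_denominator_set S \<and>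
         {r. \<exists>s\<in>S. r * s = 0} = {0}}"
proof -
  have eq: "{r. \<exists>s\<in>S. s * r = 0} = {r. \<exists>s\<in>S. r * s = 0}"
    if "left_denominator_set S" "right_denominator_set S" for S :: "'a set"
    using that unfolding left_denominator_set_def right_denominator_set_def by blast
  show ?thesis
    unfolding Den0_def by (simp add: eq cong: conj_cong)
qed

text \<open>\<open>R\<^sup>l\<^sup>e\<close>, \<open>R\<^sup>r\<^sup>e\<close> and \<open>R\<^sup>e\<close>\<close>

definition left_ess :: "'a::ring_1 set" where
  "left_ess = {r. essential_left_ideal (range (\<lambda>x. x * r))}"

definition right_ess :: "'a::ring_1 set" where
  "right_ess = {r. essential_right_ideal (range (\<lambda>x. r * x))}"

definition ess :: "'a::ring_1 set" where
  "ess = left_ess \<inter> right_ess"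

text \<open>\<open>'C\<^sub>R\<close>, \<open>C'\<^sub>R\<close> and \<open>C\<^sub>R\<close>; ``left'' and ``right'' refer to the position of the prime.\<close>

definition left_reg :: "'a::ring_1 set" where
  "left_reg = {c. \<forall>r. r * c = 0 \<longrightarrow> r = 0}"

definition right_reg :: "'a::ring_1 set" where
  "right_reg = {c. \<forall>r. c * r = 0 \<longrightarrow> r = 0}"

definition reg :: "'a::ring_1 set" where
  "reg = left_reg \<inter> right_reg"

text \<open>\<open>'C\<^sub>R\<^sup>l\<^sup>e\<close>, \<open>C'\<^sub>R\<^sup>r\<^sup>e\<close> and \<open>C\<^sub>R\<^sup>e\<close>\<close>

definition left_reg_ess :: "'a::ring_1 set" where
  "left_reg_ess = left_reg \<inter> left_ess"

definition right_reg_ess :: "'a::ring_1 set" where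
  "right_reg_ess = right_reg \<inter> right_ess"

definition reg_ess :: "'a::ring_1 set" where
  "reg_ess = left_reg_ess \<inter> right_reg_ess"

lemma reg_ess_eq: "reg_ess = reg \<inter> ess"
  unfolding reg_ess_def left_reg_ess_def right_reg_ess_def reg_def ess_def by blast

end

theory Submission
  imports Defs
begin

text \<open>
  A left ideal is essential iff every nonzero element has a nonzero left multiple in it.
  Hence if \<open>R s\<close> is essential, then so is \<open>{t. t r \<in> R s}\<close> for every \<open>r\<close>. An element of this
  left ideal lying in a multiplicative set \<open>S \<ni> s\<close> is exactly what the left Ore condition on
  \<open>S\<close> asks for.
\<close>

section \<open>Essential left ideals and left denominator sets\<close>

lemma left_ideal_range: "left_ideal (range (\<lambda>x. x * c))"
  unfolding left_ideal_def
proof (intro conjI allI ballI)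
  show "0 \<in> range (\<lambda>x. x * c)"
    by (rule range_eqI [of _ _ 0]) simp
  show "x + y \<in> range (\<lambda>x. x * c)" if "x \<in> range (\<lambda>x. x * c)" "y \<in> range (\<lambda>x. x * c)" for x y
    using that by (auto simp flip: distrib_right)
  show "r * x \<in> range (\<lambda>x. x * c)" if "x \<in> range (\<lambda>x. x * c)" for r x
    using that by (auto simp flip: mult.assoc)
qed

text \<open>It suffices to test \<open>I\<close> against the principal left ideals generated by
  nonzero \<open>x\<close>, because every nonzero left ideal contains one of these.\<close>

lemma essential_left_ideal_iff:
  "essential_left_ideal I \<longleftrightarrow> left_ideal I \<and> (\<forall>x. x \<noteq> 0 \<longrightarrow> (\<exists>r. r * x \<noteq> 0 \<and> r * x \<in> I))"
proof (intro iffI conjI allI impI)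
  assume I: "essential_left_ideal I"
  then show "left_ideal I"
    by (simp add: essential_left_ideal_def)
  fix x :: 'a assume "x \<noteq> 0"
  let ?J = "range (\<lambda>r. r * x)"
  have "x \<in> ?J"
    by (rule range_eqI [of _ _ 1]) simp
  with \<open>x \<noteq> 0\<close> have "?J \<noteq> {0}"
    by blast
  then have "I \<inter> ?J \<noteq> {0}"
    using I left_ideal_range by (auto simp: essential_left_ideal_def)
  \<comment> \<open>An intersection different from \<open>{0}\<close> might still be empty;
    containing 0, it must have a nonzero element as well.\<close>
  moreover have "0 \<in> I \<inter> ?J"
    using I left_ideal_range [of x] by (simp add: essential_left_ideal_def left_ideal_def)
  ultimately show "\<exists>r. r * x \<noteq> 0 \<and> r * x \<in> I"
    by blast
next
  assume I: "left_ideal I \<and> (\<forall>x. x \<noteq> 0 \<longrightarrow> (\<exists>r. r * x \<noteq> 0 \<and> r * x \<in> I))"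
  have "I \<inter> J \<noteq> {0}" if J: "left_ideal J" "J \<noteq> {0}" for J
  proof -
    obtain x where x: "x \<in> J" "x \<noteq> 0"
      using J by (auto simp: left_ideal_def)
    with I obtain r where "r * x \<noteq> 0" "r * x \<in> I"
      by blast
    moreover have "r * x \<in> J"
      using J x by (simp add: left_ideal_def)
    ultimately show ?thesis
      by blast
  qed
  with I show "essential_left_ideal I"
    by (simp add: essential_left_ideal_def)
qed

text \<open>Turns essentiality into an equation \<open>r * x = u * c\<close>, whose multiplier
  \<open>u\<close> can in turn be moved into another principal left ideal. This is how products are
  handled below.\<close>

lemma left_ess_iff:
  "c \<in> left_ess \<longleftrightarrow> (\<forall>x. x \<noteq> 0 \<longrightarrow> (\<exists>r u. r * x \<noteq> 0 \<and> r * x = u * c))"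
  unfolding left_ess_def mem_Collect_eq essential_left_ideal_iff using left_ideal_range by blast

text \<open>For a product \<open>c * d\<close>, a nonzero \<open>x\<close> is first multiplied into
  R\<open>d\<close>, giving \<open>u * d\<close>; then \<open>u\<close> is multiplied into
  R\<open>c\<close>. Cancelling \<open>d\<close> on the right shows that the resulting multiple of
  \<open>x\<close> is still nonzero.\<close>

lemma multiplicative_set_left_reg_ess: "multiplicative_set left_reg_ess"
proof -
  have "c * d \<in> left_ess" if c: "c \<in> left_ess" and d: "d \<in> left_ess" "d \<in> left_reg" for c d :: 'a
    unfolding left_ess_iff
  proof (intro allI impI)
    fix x :: 'a assume "x \<noteq> 0"
    then obtain r u where ru: "r * x \<noteq> 0" "r * x = u * d"
      using d left_ess_iff by blast
    then have "u \<noteq> 0"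
      by auto
    then obtain q v where qv: "q * u \<noteq> 0" "q * u = v * c"
      using c left_ess_iff by blast
    have "(q * r) * x = (q * u) * d"
      using ru by (simp add: mult.assoc)
    \<comment> \<open>Regularity of \<open>d\<close> enters here: \<open>q * u\<close> is nonzero,
      so multiplying by \<open>d\<close> on the right cannot kill it.\<close>
    moreover have "(q * u) * d \<noteq> 0"
      using qv d by (auto simp: left_reg_def)
    moreover have "(q * u) * d = v * (c * d)"
      using qv by (simp add: mult.assoc)
    ultimately show "\<exists>r u. r * x \<noteq> 0 \<and> r * x = u * (c * d)"
      by (intro exI [of _ "q * r"] exI [of _ v]) simp
  qed
  moreover have "c * d \<in> left_reg" if "c \<in> left_reg" "d \<in> left_reg" for c d :: 'a
    using that unfolding left_reg_def mem_Collect_eq by (metis mult.assoc)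
  moreover have "(1::'a) \<in> left_ess"
    unfolding left_ess_iff
  proof (intro allI impI)
    fix x :: 'a assume "x \<noteq> 0"
    then have "1 * x \<noteq> 0 \<and> 1 * x = x * 1"
      by simp
    then show "\<exists>r u. r * x \<noteq> 0 \<and> r * x = u * 1"
      by blast
  qed
  \<comment> \<open>The witness 1 excludes 0: \<open>1 * 0 = 0\<close> although 1 is nonzero in
    R.\<close>
  moreover have "(1::'a) \<in> left_reg" "(0::'a) \<notin> left_reg"
    by (auto simp: left_reg_def intro: exI [of _ 1])
  ultimately show ?thesis
    unfolding multiplicative_set_def left_reg_ess_def by blast
qed

text \<open>A nonzero \<open>x\<close> with \<open>x * r = 0\<close> already lies in the colon
  ideal. Otherwise some multiple of \<open>x * r\<close> is nonzero and in \<open>I\<close>, and the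
  same multiplier works for \<open>x\<close>.\<close>

lemma essential_left_ideal_colon:
  assumes "essential_left_ideal I"
  shows "essential_left_ideal {t. t * r \<in> I}"
  unfolding essential_left_ideal_iff
proof (intro conjI allI impI)
  show "left_ideal {t. t * r \<in> I}"
    using assms by (simp add: essential_left_ideal_def left_ideal_def distrib_right mult.assoc)
  fix x :: 'a assume "x \<noteq> 0"
  show "\<exists>q. q * x \<noteq> 0 \<and> q * x \<in> {t. t * r \<in> I}"
  proof (cases "x * r = 0")
    case True
    then have "1 * x \<noteq> 0 \<and> 1 * x \<in> {t. t * r \<in> I}"
      using \<open>x \<noteq> 0\<close> assms by (simp add: essential_left_ideal_def left_ideal_def)
    then show ?thesis
      by blast
  next
    case False
    then obtain q where q: "q * (x * r) \<noteq> 0" "q * (x * r) \<in> I"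
      using assms essential_left_ideal_iff by blast
    then have "q * x \<noteq> 0 \<and> q * x \<in> {t. t * r \<in> I}"
      by (auto simp flip: mult.assoc)
    then show ?thesis
      by blast
  qed
qed

text \<open>Stated for an arbitrary multiplicative \<open>S\<close> inside
  \<open>left_reg_ess\<close>, so that it applies both to \<open>left_reg_ess\<close> and to the
  smaller set \<open>reg_ess\<close>.\<close>

lemma left_denominator_setI:
  assumes S: "multiplicative_set S" "S \<subseteq> left_reg_ess"
    and meets: "\<And>I. essential_left_ideal I \<Longrightarrow> S \<inter> I \<noteq> {}"
  shows "left_denominator_set S"
  unfolding left_denominator_set_def left_Ore_set_def
proof (intro conjI allI ballI impI S)
  fix r s assume "s \<in> S"
  then have "essential_left_ideal (range (\<lambda>u. u * s))"
    using S by (auto simp: left_reg_ess_def left_ess_def)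
  then have "S \<inter> {t. t * r \<in> range (\<lambda>u. u * s)} \<noteq> {}"
    by (intro meets essential_left_ideal_colon)
  then show "(\<lambda>t. t * r) ` S \<inter> range (\<lambda>u. u * s) \<noteq> {}"
    by blast
next
  fix r s assume "s \<in> S" "r * s = 0"
  then have "r = 0"
    using S by (auto simp: left_reg_ess_def left_reg_def)
  then show "\<exists>t\<in>S. t * r = 0"
    using S by (auto simp: multiplicative_set_def)
qed

section \<open>The mirror image: essential right ideals and right denominator sets\<close>

lemma right_ideal_range: "right_ideal (range (\<lambda>x. c * x))"
  unfolding right_ideal_def
proof (intro conjI allI ballI)
  show "0 \<in> range (\<lambda>x. c * x)"
    by (rule range_eqI [of _ _ 0]) simp
  show "x + y \<in> range (\<lambda>x. c * x)" if "x \<in> range (\<lambda>x. c * x)" "y \<in> range (\<lambda>x. c * x)" for x y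
    using that by (auto simp flip: distrib_left)
  show "x * r \<in> range (\<lambda>x. c * x)" if "x \<in> range (\<lambda>x. c * x)" for r x
    using that by (auto simp: mult.assoc)
qed

lemma essential_right_ideal_iff:
  "essential_right_ideal I \<longleftrightarrow> right_ideal I \<and> (\<forall>x. x \<noteq> 0 \<longrightarrow> (\<exists>r. x * r \<noteq> 0 \<and> x * r \<in> I))"
proof (intro iffI conjI allI impI)
  assume I: "essential_right_ideal I"
  then show "right_ideal I"
    by (simp add: essential_right_ideal_def)
  fix x :: 'a assume "x \<noteq> 0"
  let ?J = "range (\<lambda>r. x * r)"
  have "x \<in> ?J"
    by (rule range_eqI [of _ _ 1]) simp
  with \<open>x \<noteq> 0\<close> have "?J \<noteq> {0}"
    by blast
  then have "I \<inter> ?J \<noteq> {0}"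
    using I right_ideal_range by (auto simp: essential_right_ideal_def)
  moreover have "0 \<in> I \<inter> ?J"
    using I right_ideal_range [of x] by (simp add: essential_right_ideal_def right_ideal_def)
  ultimately show "\<exists>r. x * r \<noteq> 0 \<and> x * r \<in> I"
    by blast
next
  assume I: "right_ideal I \<and> (\<forall>x. x \<noteq> 0 \<longrightarrow> (\<exists>r. x * r \<noteq> 0 \<and> x * r \<in> I))"
  have "I \<inter> J \<noteq> {0}" if J: "right_ideal J" "J \<noteq> {0}" for J
  proof -
    obtain x where x: "x \<in> J" "x \<noteq> 0"
      using J by (auto simp: right_ideal_def)
    with I obtain r where "x * r \<noteq> 0" "x * r \<in> I"
      by blast
    moreover have "x * r \<in> J"
      using J x by (simp add: right_ideal_def)
    ultimately show ?thesis
      by blast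
  qed
  with I show "essential_right_ideal I"
    by (simp add: essential_right_ideal_def)
qed

lemma right_ess_iff:
  "c \<in> right_ess \<longleftrightarrow> (\<forall>x. x \<noteq> 0 \<longrightarrow> (\<exists>r u. x * r \<noteq> 0 \<and> x * r = c * u))"
  unfolding right_ess_def mem_Collect_eq essential_right_ideal_iff using right_ideal_range by blast

text \<open>The left-hand argument with all products reversed: \<open>x\<close> is first multiplied
  into \<open>d\<close>R, then the cofactor \<open>u\<close> into \<open>c\<close>R, and now
  \<open>d\<close> is cancelled on the left. Hence the product considered is
  \<open>d * c\<close>.\<close>

lemma multiplicative_set_right_reg_ess: "multiplicative_set right_reg_ess"
proof -
  have "d * c \<in> right_ess" if c: "c \<in> right_ess" and d: "d \<in> right_ess" "d \<in> right_reg" for c d :: 'a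
    unfolding right_ess_iff
  proof (intro allI impI)
    fix x :: 'a assume "x \<noteq> 0"
    then obtain r u where ru: "x * r \<noteq> 0" "x * r = d * u"
      using d right_ess_iff by blast
    then have "u \<noteq> 0"
      by auto
    then obtain q v where qv: "u * q \<noteq> 0" "u * q = c * v"
      using c right_ess_iff by blast
    have "x * (r * q) = d * (u * q)"
      using ru by (simp flip: mult.assoc)
    moreover have "d * (u * q) \<noteq> 0"
      using qv d by (auto simp: right_reg_def)
    moreover have "d * (u * q) = (d * c) * v"
      using qv by (simp flip: mult.assoc)
    ultimately show "\<exists>r u. x * r \<noteq> 0 \<and> x * r = (d * c) * u"
      by (intro exI [of _ "r * q"] exI [of _ v]) simp
  qed
  moreover have "d * c \<in> right_reg" if "c \<in> right_reg" "d \<in> right_reg" for c d :: 'a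
    using that unfolding right_reg_def mem_Collect_eq by (metis mult.assoc)
  moreover have "(1::'a) \<in> right_ess"
    unfolding right_ess_iff
  proof (intro allI impI)
    fix x :: 'a assume "x \<noteq> 0"
    then have "x * 1 \<noteq> 0 \<and> x * 1 = 1 * x"
      by simp
    then show "\<exists>r u. x * r \<noteq> 0 \<and> x * r = 1 * u"
      by blast
  qed
  moreover have "(1::'a) \<in> right_reg" "(0::'a) \<notin> right_reg"
    by (auto simp: right_reg_def intro: exI [of _ 1])
  ultimately show ?thesis
    unfolding multiplicative_set_def right_reg_ess_def by blast
qed

text \<open>Again either \<open>r * x = 0\<close> and \<open>x\<close> itself qualifies, or a
  multiplier \<open>q\<close> taking \<open>r * x\<close> to a nonzero element of \<open>I\<close>
  also serves for \<open>x\<close>.\<close>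

lemma essential_right_ideal_colon:
  assumes "essential_right_ideal I"
  shows "essential_right_ideal {t. r * t \<in> I}"
  unfolding essential_right_ideal_iff
proof (intro conjI allI impI)
  show "right_ideal {t. r * t \<in> I}"
    using assms by (simp add: essential_right_ideal_def right_ideal_def distrib_left flip: mult.assoc)
  fix x :: 'a assume "x \<noteq> 0"
  show "\<exists>q. x * q \<noteq> 0 \<and> x * q \<in> {t. r * t \<in> I}"
  proof (cases "r * x = 0")
    case True
    then have "x * 1 \<noteq> 0 \<and> x * 1 \<in> {t. r * t \<in> I}"
      using \<open>x \<noteq> 0\<close> assms by (simp add: essential_right_ideal_def right_ideal_def)
    then show ?thesis
      by blast
  next
    case False
    then obtain q where q: "(r * x) * q \<noteq> 0" "(r * x) * q \<in> I"
      using assms essential_right_ideal_iff by blast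
    then have "x * q \<noteq> 0 \<and> x * q \<in> {t. r * t \<in> I}"
      by (auto simp: mult.assoc)
    then show ?thesis
      by blast
  qed
qed

lemma right_denominator_setI:
  assumes S: "multiplicative_set S" "S \<subseteq> right_reg_ess"
    and meets: "\<And>I. essential_right_ideal I \<Longrightarrow> S \<inter> I \<noteq> {}"
  shows "right_denominator_set S"
  unfolding right_denominator_set_def right_Ore_set_def
proof (intro conjI allI ballI impI S)
  fix r s assume "s \<in> S"
  then have "essential_right_ideal (range (\<lambda>u. s * u))"
    using S by (auto simp: right_reg_ess_def right_ess_def)
  then have "S \<inter> {t. r * t \<in> range (\<lambda>u. s * u)} \<noteq> {}"
    by (intro meets essential_right_ideal_colon)
  then show "(\<lambda>t. r * t) ` S \<inter> range (\<lambda>u. s * u) \<noteq> {}"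
    by blast
next
  fix r s assume "s \<in> S" "s * r = 0"
  \<comment> \<open>Elements of \<open>S\<close> are cancellable on the left, so the denominator
    condition only concerns \<open>r = 0\<close>, where any \<open>t\<close> in \<open>S\<close>
    will do.\<close>
  then have "r = 0"
    using S by (auto simp: right_reg_ess_def right_reg_def)
  then show "\<exists>t\<in>S. r * t = 0"
    using S by (auto simp: multiplicative_set_def)
qed

section \<open>Assembly of the four claims\<close>

theorem proposition2p10:
  shows "(multiplicative_set (left_reg_ess :: 'a::ring_1 set) \<and>
          multiplicative_set (right_reg_ess :: 'a set) \<and>
          multiplicative_set (reg_ess :: 'a set)) \<and>
         ((\<forall>I :: 'a set. essential_left_ideal I \<longrightarrow> left_reg_ess \<inter> I \<noteq> {}) \<longrightarrow>
          left_denominator_set (left_reg_ess :: 'a set)) \<and>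
         ((\<forall>I :: 'a set. essential_right_ideal I \<longrightarrow> right_reg_ess \<inter> I \<noteq> {}) \<longrightarrow>
          right_denominator_set (right_reg_ess :: 'a set)) \<and>
         ((\<forall>I :: 'a set. essential_left_ideal I \<longrightarrow> reg_ess \<inter> I \<noteq> {}) \<and>
          (\<forall>I :: 'a set. essential_right_ideal I \<longrightarrow> reg_ess \<inter> I \<noteq> {}) \<longrightarrow>
          (reg_ess :: 'a set) \<in> Den0)"
proof (intro conjI impI)
  show left: "multiplicative_set (left_reg_ess :: 'a set)"
    by (rule multiplicative_set_left_reg_ess)
  show right: "multiplicative_set (right_reg_ess :: 'a set)"
    by (rule multiplicative_set_right_reg_ess)
  \<comment> \<open>An intersection of two multiplicative sets is multiplicative.\<close>
  show reg: "multiplicative_set (reg_ess :: 'a set)"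
    using left right by (simp add: multiplicative_set_def reg_ess_def)
  show "left_denominator_set (left_reg_ess :: 'a set)"
    if "\<forall>I :: 'a set. essential_left_ideal I \<longrightarrow> left_reg_ess \<inter> I \<noteq> {}"
    using that left by (intro left_denominator_setI) auto
  show "right_denominator_set (right_reg_ess :: 'a set)"
    if "\<forall>I :: 'a set. essential_right_ideal I \<longrightarrow> right_reg_ess \<inter> I \<noteq> {}"
    using that right by (intro right_denominator_setI) auto
  assume meets: "(\<forall>I :: 'a set. essential_left_ideal I \<longrightarrow> reg_ess \<inter> I \<noteq> {}) \<and>
    (\<forall>I :: 'a set. essential_right_ideal I \<longrightarrow> reg_ess \<inter> I \<noteq> {})"
  \<comment> \<open>\<open>reg_ess\<close> lies in both one-sided sets, so each criterion applies to
    it directly.\<close>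
  have "left_denominator_set (reg_ess :: 'a set)"
    using meets reg by (intro left_denominator_setI) (auto simp: reg_ess_def)
  moreover have "right_denominator_set (reg_ess :: 'a set)"
    using meets reg by (intro right_denominator_setI) (auto simp: reg_ess_def)
  moreover have "r = 0" if "s \<in> reg_ess" "s * r = 0" for r s :: 'a
    using that by (simp add: reg_ess_def right_reg_ess_def right_reg_def)
  \<comment> \<open>Left cancellation gives one inclusion; 0 belongs to the annihilator set because
    \<open>reg_ess\<close> contains 1 and so is nonempty.\<close>
  then have "{r :: 'a. \<exists>s\<in>reg_ess. s * r = 0} = {0}"
    using reg by (auto simp: multiplicative_set_def)
  ultimately show "(reg_ess :: 'a set) \<in> Den0"
    by (simp add: Den0_def)
qed

end
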